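(* Let $A\in\mathbb{R}^{n\times n}$ be a group monotone matrix and let $A=K-L=U-V=X-Y$ be three proper G-weak regular splittings of type II of $A$, with $\mathcal{R}(K+X-A+YU^{\#}L)=\mathcal{R}(A)$ and $\mathcal{N}(K+X-A+YU^{\#}L)=\mathcal{N}(A)$. Let $\mathcal{H}=X^{\#}YU^{\#}VK^{\#}L$ and $\mathcal{S}=YX^{\#}VU^{\#}LK^{\#}$, and let $A=B-C$ be the proper G-weak regular splitting of type II induced by $\mathcal{S}$. If $KB^{\#}\ge I$, $UB^{\#}\ge I$ and $XB^{\#}\ge I$, then $$\rho(\mathcal{H})\le\min\{\rho(K^{\#}L),\rho(U^{\#}V),\rho(X^{\#}Y)\}<1.$$
   Context: All matrices are real $n\times n$; $\mathcal{R}(\cdot)$, $\mathcal{N}(\cdot)$ denote range and null space; $\rho$ is the spectral radius; inequalities between matrices are entrywise ($B\ge D$ means $B-D$ has nonnegative entries). The group inverse of $A$, when it exists, is the unique matrix $A^{\#}$ with $AA^{\#}A=A$, $A^{\#}AA^{\#}=A^{\#}$, $AA^{\#}=A^{\#}A$; it exists iff $\mathrm{rank}(A)=\mathrm{rank}(A^2)$. $A$ is group monotone if $A^{\#}$ exists and $A^{\#}\ge 0$. An expression $A=U-V$ is a proper splitting of $A$ if $\mathcal{R}(U)=\mathcal{R}(A)$ and $\mathcal{N}(U)=\mathcal{N}(A)$. A proper splitting $A=U-V$ is a proper G-weak regular splitting of type II if $U^{\#}$ exists, $U^{\#}\ge 0$ and $VU^{\#}\ge 0$. The splitting $A=B-C$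 induced by $\mathcal{S}$ is the proper splitting with $CB^{\#}=\mathcal{S}$, namely $B=(I-\mathcal{S})^{-1}A$, $C=B-A$. *)

theory Defs
  imports "HOL-Analysis.Analysis"
begin

(* Throughout, \<le> on real ^ 'n ^ 'n is the library's componentwise order, i.e. the
   entrywise order of matrices. *)

definition null_space :: "real ^ 'n ^ 'n \<Rightarrow> (real ^ 'n) set" where
  "null_space A = {x. A *v x = 0}"

definition complex_eigenvalues :: "real ^ 'n ^ 'n \<Rightarrow> complex set" where
  "complex_eigenvalues A =
     {\<mu>. \<exists>x. x \<noteq> 0 \<and> map_matrix complex_of_real A *v x = \<mu> *s x}"

definition spectral_radius :: "real ^ 'n ^ 'n \<Rightarrow> real" where
  "spectral_radius A = Max (cmod ` complex_eigenvalues A)"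

definition is_group_inverse :: "real ^ 'n ^ 'n \<Rightarrow> real ^ 'n ^ 'n \<Rightarrow> bool" where
  "is_group_inverse A G \<longleftrightarrow> A ** G ** A = A \<and> G ** A ** G = G \<and> A ** G = G ** A"

lemma is_group_inverse_unique:
  assumes "is_group_inverse A G" and "is_group_inverse A G'"
  shows "G = G'"
proof -
  have e: "A ** G = A ** G'"
    using assms unfolding is_group_inverse_def by (metis matrix_mul_assoc)
  have "G = G ** (A ** G)"
    using assms unfolding is_group_inverse_def by (metis matrix_mul_assoc)
  also have "\<dots> = A ** G ** G'"
    using assms e unfolding is_group_inverse_def by (metis matrix_mul_assoc)
  also have "\<dots> = G'"
    using assms e unfolding is_group_inverse_def by (metis matrix_mul_assoc)
  finally show ?thesis .
qed

definition group_invertible :: "real ^ 'n ^ 'n \<Rightarrow> bool" where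
  "group_invertible A \<longleftrightarrow> (\<exists>G. is_group_inverse A G)"

definition group_inv :: "real ^ 'n ^ 'n \<Rightarrow> real ^ 'n ^ 'n" where
  "group_inv A = (THE G. is_group_inverse A G)"

lemma group_inv_eqI: "is_group_inverse A G \<Longrightarrow> group_inv A = G"
  unfolding group_inv_def using is_group_inverse_unique by blast

definition group_monotone :: "real ^ 'n ^ 'n \<Rightarrow> bool" where
  "group_monotone A \<longleftrightarrow> group_invertible A \<and> 0 \<le> group_inv A"

definition proper_splitting ::
    "real ^ 'n ^ 'n \<Rightarrow> real ^ 'n ^ 'n \<Rightarrow> real ^ 'n ^ 'n \<Rightarrow> bool" where
  "proper_splitting A U V \<longleftrightarrow>
     A = U - V \<and> range ((*v) U) = range ((*v) A) \<and> null_space U = null_space A"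

definition proper_G_weak_regular_II ::
    "real ^ 'n ^ 'n \<Rightarrow> real ^ 'n ^ 'n \<Rightarrow> real ^ 'n ^ 'n \<Rightarrow> bool" where
  "proper_G_weak_regular_II A U V \<longleftrightarrow>
     proper_splitting A U V \<and> group_invertible U \<and> 0 \<le> group_inv U \<and> 0 \<le> V ** group_inv U"

(* Only the closed formula is recorded here; when I - S is singular, matrix_inv is an
   unspecified value.  Lemma three_step_induced below shows that, for the S of the three-step
   scheme, I - S is invertible and (B, C) satisfies this definition iff A = B - C is a proper
   G-weak regular splitting of type II with C B^# = S. *)
definition induced_splitting ::
    "real ^ 'n ^ 'n \<Rightarrow> real ^ 'n ^ 'n \<Rightarrow> real ^ 'n ^ 'n \<Rightarrow> real ^ 'n ^ 'n \<Rightarrow> bool" where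
  "induced_splitting A S B C \<longleftrightarrow> B = matrix_inv (mat 1 - S) ** A \<and> C = B - A"

lemma mat_diff_left: "(A - B) ** (D :: real ^ 'n ^ 'n) = A ** D - B ** D"
  by (simp add: matrix_matrix_mult_def vec_eq_iff algebra_simps sum_subtractf)

lemma mat_diff_right: "(D :: real ^ 'n ^ 'n) ** (A - B) = D ** A - D ** B"
  by (simp add: matrix_matrix_mult_def vec_eq_iff algebra_simps sum_subtractf)

lemma mat_mult_nonneg: "0 \<le> A \<Longrightarrow> 0 \<le> B \<Longrightarrow> 0 \<le> A ** (B :: real ^ 'n ^ 'n)"
  by (auto simp: matrix_matrix_mult_def less_eq_vec_def intro!: sum_nonneg)

lemma mat_vec_nonneg: "0 \<le> A \<Longrightarrow> 0 \<le> x \<Longrightarrow> 0 \<le> A *v (x :: real ^ 'n)"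
  by (auto simp: matrix_vector_mult_def less_eq_vec_def intro!: sum_nonneg)

lemma is_group_inverse_group_inv: "group_invertible A \<Longrightarrow> is_group_inverse A (group_inv A)"
  unfolding group_invertible_def using group_inv_eqI by blast

lemma matrix_inv_inverse:
  "invertible M \<Longrightarrow> M ** matrix_inv M = mat 1 \<and> matrix_inv M ** M = mat 1"
  unfolding invertible_def matrix_inv_def by (rule someI_ex)

lemma proj_absorb_left:
  assumes "is_group_inverse U W" "range ((*v) U) = range ((*v) A)"
  shows "U ** W ** A = A"
proof -
  have "(U ** W ** A) *v x = A *v x" for x
  proof -
    obtain y where y: "A *v x = U *v y" using assms(2) by (metis rangeE rangeI)
    have "(U ** W ** A) *v x = (U ** W ** U) *v y"
      using y by (simp add: matrix_vector_mul_assoc[symmetric])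
    moreover have "U ** W ** U = U" using assms(1) unfolding is_group_inverse_def by blast
    ultimately show ?thesis using y by simp
  qed
  then show ?thesis by (simp add: matrix_eq)
qed

lemma proj_absorb_right:
  assumes "is_group_inverse U W" "null_space U = null_space A"
  shows "A ** W ** U = A"
proof -
  have "(A ** W ** U) *v x = A *v x" for x
  proof -
    have "U ** W ** U = U" using assms(1) unfolding is_group_inverse_def by blast
    then have "U *v (x - (W ** U) *v x) = 0"
      by (simp add: algebra_simps matrix_vector_mul_assoc matrix_mul_assoc)
    then have "A *v (x - (W ** U) *v x) = 0" using assms(2) by (auto simp: null_space_def)
    then show ?thesis by (simp add: algebra_simps matrix_vector_mul_assoc matrix_mul_assoc)
  qed
  then show ?thesis by (simp add: matrix_eq)
qed

lemma proper_splitting_proj: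
  assumes "is_group_inverse A G" "is_group_inverse U W" "proper_splitting A U V"
  shows "U ** W = A ** G"
proof -
  have 1: "U ** W ** A = A" "A ** W ** U = A"
    using proj_absorb_left[OF assms(2)] proj_absorb_right[OF assms(2)] assms(3)
    unfolding proper_splitting_def by auto
  have 2: "A ** G ** U = U"
    using proj_absorb_left[OF assms(1), of U] assms(3) unfolding proper_splitting_def by auto
  have "A ** (U ** W) = A"
    using 1(2) assms(2) unfolding is_group_inverse_def by (metis matrix_mul_assoc)
  then have "G ** A ** (U ** W) = G ** A" by (metis matrix_mul_assoc)
  then have "A ** G ** (U ** W) = A ** G"
    using assms(1) unfolding is_group_inverse_def by metis
  then show ?thesis using 2 by (metis matrix_mul_assoc)
qed

lemma induced_splitting_characterization:
  assumes G: "is_group_inverse A G" and inv: "invertible (mat 1 - S)"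
    and S: "A ** G ** S = S" "S ** (A ** G) = S"
  shows "induced_splitting A S B C \<longleftrightarrow>
           proper_splitting A B C \<and> group_invertible B \<and> C ** group_inv B = S"
proof
  define N where "N = matrix_inv (mat 1 - S)"
  have N: "(mat 1 - S) ** N = mat 1" "N ** (mat 1 - S) = mat 1"
    using matrix_inv_inverse[OF inv] by (auto simp: N_def)
  have G1: "A ** G ** A = A" "G ** A ** G = G" "A ** G = G ** A"
    using G by (auto simp: is_group_inverse_def)
  let ?P = "A ** G"
  assume "induced_splitting A S B C"
  then have B: "B = N ** A" and C: "C = B - A" by (auto simp: induced_splitting_def N_def)
  have comm: "?P ** (mat 1 - S) = (mat 1 - S) ** ?P"
    using S by (simp add: mat_diff_left mat_diff_right)
  have commN: "?P ** N = N ** ?P"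
  proof -
    have "?P ** N = N ** (mat 1 - S) ** ?P ** N" by (simp add: N)
    also have "\<dots> = N ** (?P ** (mat 1 - S)) ** N" by (simp add: comm matrix_mul_assoc)
    also have "\<dots> = N ** ?P ** ((mat 1 - S) ** N)" by (simp add: matrix_mul_assoc)
    finally show ?thesis by (simp add: N)
  qed
  have SB: "A = (mat 1 - S) ** B" by (simp add: B matrix_mul_assoc N)
  have PB: "?P ** B = B" by (metis B commN G1(1) matrix_mul_assoc)
  have BP: "B = B ** G ** A" by (metis B G1(1) matrix_mul_assoc)
  define D where "D = G ** (mat 1 - S)"
  have BD: "B ** D = ?P"
    by (metis B D_def N(2) comm matrix_mul_assoc matrix_mul_lid)
  have DB: "D ** B = ?P"
    by (metis B D_def N(1) G1(3) matrix_mul_assoc matrix_mul_lid)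
  have "D ** ?P = D"
    by (metis D_def comm G1(2,3) matrix_mul_assoc)
  then have D: "is_group_inverse B D"
    unfolding is_group_inverse_def using BD DB PB by (metis matrix_mul_assoc)
  then have gB: "group_inv B = D" by (rule group_inv_eqI)
  have "C ** D = ?P - A ** G ** (mat 1 - S)"
    by (simp add: C mat_diff_left BD, simp add: D_def matrix_mul_assoc)
  then have CS: "C ** D = S" using S by (simp add: mat_diff_right)
  have "range ((*v) B) = range ((*v) A)"
  proof
    have "B *v x \<in> range ((*v) A)" for x
      using PB by (metis matrix_vector_mul_assoc rangeI)
    moreover have "A *v x \<in> range ((*v) B)" for x
      by (metis BD G1(1) matrix_vector_mul_assoc rangeI)
    ultimately show "range ((*v) B) \<subseteq> range ((*v) A)" "range ((*v) A) \<subseteq> range ((*v) B)"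
      by auto
  qed
  moreover have "null_space B = null_space A"
    unfolding null_space_def
    by (metis B SB matrix_vector_mul_assoc matrix_vector_mult_0_right)
  ultimately show "proper_splitting A B C \<and> group_invertible B \<and> C ** group_inv B = S"
    using C CS D gB unfolding proper_splitting_def group_invertible_def by auto
next
  assume a: "proper_splitting A B C \<and> group_invertible B \<and> C ** group_inv B = S"
  define D where "D = group_inv B"
  have D: "is_group_inverse B D" using a is_group_inverse_group_inv by (auto simp: D_def)
  have A: "A = B - C" and CS: "C ** D = S" using a by (auto simp: proper_splitting_def D_def)
  have "A ** D ** B = A"
    using proj_absorb_right[OF D] a by (auto simp: proper_splitting_def)
  moreover have "B ** D ** B = B" using D unfolding is_group_inverse_def by blast
  ultimately have "C ** D ** B = C" by (simp add: A mat_diff_left)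
  then have "A = (mat 1 - S) ** B" by (simp add: CS A mat_diff_left)
  then have "B = matrix_inv (mat 1 - S) ** A"
    using matrix_inv_inverse[OF inv] by (simp add: matrix_mul_assoc)
  then show "induced_splitting A S B C" by (simp add: induced_splitting_def A)
qed

lemma splitting_facts:
  assumes G: "is_group_inverse A G" and s: "proper_G_weak_regular_II A U V"
  defines "W \<equiv> group_inv U" and "T \<equiv> V ** group_inv U"
  shows "0 \<le> W" "0 \<le> T" "A ** G ** T = T" "T ** (A ** G) = T" "G ** (A ** G - T) = W"
proof -
  have W: "is_group_inverse U W" and p: "proper_splitting A U V"
    using s is_group_inverse_group_inv by (auto simp: proper_G_weak_regular_II_def W_def)
  show "0 \<le> W" "0 \<le> T" using s by (auto simp: proper_G_weak_regular_II_def W_def T_def)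
  have P: "U ** W = A ** G" by (rule proper_splitting_proj[OF G W p])
  have V: "V = U - A" using p by (simp add: proper_splitting_def)
  have T: "T = A ** G - A ** W"
    unfolding T_def W_def[symmetric] by (simp add: V mat_diff_left P)
  have WP: "W ** (A ** G) = W" "(A ** G) ** W = W"
    using W P unfolding is_group_inverse_def by (metis matrix_mul_assoc)+
  have G1: "A ** G ** A = A" "G ** A ** G = G" "A ** G = G ** A"
    using G by (auto simp: is_group_inverse_def)
  show "A ** G ** T = T" 
    by (simp add: T mat_diff_right matrix_mul_assoc G1(1))
  show "T ** (A ** G) = T"
    using WP(1) by (simp add: T mat_diff_left matrix_mul_assoc G1(1)) (metis matrix_mul_assoc)
  have "G ** (A ** G - T) = G ** A ** W" by (simp add: T matrix_mul_assoc)
  then show "G ** (A ** G - T) = W" using WP(2) G1(3) by simp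
qed

lemma three_step_induced:
  assumes A: "group_monotone A"
    and s: "proper_G_weak_regular_II A K L" "proper_G_weak_regular_II A U V"
      "proper_G_weak_regular_II A X Y"
    and S: "S = Y ** group_inv X ** V ** group_inv U ** L ** group_inv K"
  shows "invertible (mat 1 - S)"
    and "induced_splitting A S B C \<longleftrightarrow>
           proper_G_weak_regular_II A B C \<and> C ** group_inv B = S"
proof -
  define G where "G = group_inv A"
  have G: "is_group_inverse A G" and G0: "0 \<le> G"
    using A is_group_inverse_group_inv by (auto simp: group_monotone_def G_def)
  let ?P = "A ** G"
  define TK TU TX where T: "TK = L ** group_inv K" "TU = V ** group_inv U" "TX = Y ** group_inv X"
  note K = splitting_facts[OF G s(1), folded T]
  note U = splitting_facts[OF G s(2), folded T]
  note X = splitting_facts[OF G s(3), folded T]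
  have S': "S = TX ** TU ** TK" by (simp add: S T matrix_mul_assoc)
  have S0: "0 \<le> S" unfolding S' using K U X by (auto intro!: mat_mult_nonneg)
  have SP: "?P ** S = S" "S ** ?P = S"
    unfolding S' using K(4) X(3) by (metis matrix_mul_assoc)+
  have GS: "G ** (mat 1 - S) = group_inv K + group_inv U ** TK + group_inv X ** (TU ** TK)"
  proof -
    have "group_inv K + group_inv U ** TK + group_inv X ** (TU ** TK) =
      G ** (?P - TK) + G ** (?P - TU) ** TK + G ** (?P - TX) ** (TU ** TK)"
      by (simp only: K(5) U(5) X(5))
    also have "\<dots> = G ** ?P - G ** TK + (G ** (?P ** TK) - G ** TU ** TK) +
       (G ** (?P ** TU ** TK) - G ** TX ** TU ** TK)"
      by (simp add: mat_diff_left mat_diff_right matrix_mul_assoc)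
    also have "\<dots> = G ** ?P - G ** (TX ** TU ** TK)"
      unfolding K(3) U(3) by (simp add: matrix_mul_assoc)
    also have "G ** ?P = G" using G unfolding is_group_inverse_def by (metis matrix_mul_assoc)
    finally show ?thesis by (simp add: S' mat_diff_right)
  qed
  have nn: "0 \<le> group_inv U ** TK" "0 \<le> group_inv X ** (TU ** TK)"
    using K U X by (auto intro!: mat_mult_nonneg)
  have D0: "0 \<le> G ** (mat 1 - S)"
    unfolding GS using K nn by (auto simp: less_eq_vec_def intro!: add_nonneg_nonneg)
  have "x = 0" if x: "(mat 1 - S) *v x = 0" for x
  proof -
    define a where "a = (\<chi> i. \<bar>x $ i\<bar>)"
    have Sx: "S *v x = x" using x by (simp add: algebra_simps)
    have a0: "0 \<le> a" by (auto simp: a_def less_eq_vec_def)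
    have "\<bar>(S *v x) $ i\<bar> \<le> (S *v a) $ i" for i
      using S0 by (auto simp: matrix_vector_mult_def a_def less_eq_vec_def abs_mult
          intro!: order.trans[OF sum_abs] sum_mono)
    then have "0 \<le> S *v a - a" by (simp add: Sx) (simp add: a_def less_eq_vec_def)
    from mat_vec_nonneg[OF G0 this]
    have "(G ** (mat 1 - S)) *v a \<le> 0"
      by (simp add: algebra_simps mat_diff_right matrix_vector_mul_assoc less_eq_vec_def)
    moreover have "group_inv K *v a \<le> (G ** (mat 1 - S)) *v a"
      using mat_vec_nonneg[OF nn(1) a0] mat_vec_nonneg[OF nn(2) a0]
      unfolding GS by (simp add: matrix_vector_mult_add_rdistrib less_eq_vec_def)
    ultimately have "group_inv K *v a = 0"
      using mat_vec_nonneg[OF K(1) a0] by (meson order.antisym order.trans)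
    then have "S *v a = 0"
      unfolding S by (metis matrix_vector_mul_assoc matrix_vector_mult_0_right)
    with \<open>0 \<le> S *v a - a\<close> have "a \<le> 0" by (simp add: less_eq_vec_def)
    then show "x = 0" by (simp add: a_def less_eq_vec_def vec_eq_iff)
  qed
  then show inv: "invertible (mat 1 - S)"
    using invertible_left_inverse matrix_left_invertible_ker by blast
  note ch = induced_splitting_characterization[OF G inv SP, of B C]
  have "0 \<le> group_inv B" if i: "induced_splitting A S B C"
  proof -
    have p: "proper_splitting A B C" "group_invertible B" "C ** group_inv B = S"
      using i ch by auto
    have b: "is_group_inverse B (group_inv B)" using p(2) by (rule is_group_inverse_group_inv)
    have PB: "B ** group_inv B = ?P" by (rule proper_splitting_proj[OF G b p(1)])
    have "A ** group_inv B = ?P - S"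
      using p(1,3) PB by (simp add: proper_splitting_def mat_diff_left)
    then have "G ** A ** group_inv B = G ** ?P - G ** S"
      by (simp add: mat_diff_right flip: matrix_mul_assoc)
    moreover have "G ** A ** group_inv B = group_inv B"
      using G b PB unfolding is_group_inverse_def by metis
    moreover have "G ** ?P = G" using G unfolding is_group_inverse_def by (metis matrix_mul_assoc)
    ultimately have "group_inv B = G ** (mat 1 - S)" by (simp add: mat_diff_right)
    then show ?thesis using D0 by simp
  qed
  then show "induced_splitting A S B C \<longleftrightarrow>
           proper_G_weak_regular_II A B C \<and> C ** group_inv B = S"
    using ch S0 unfolding proper_G_weak_regular_II_def by auto
qed

end

theory Submission
  imports Defs "HOL-Computational_Algebra.Fundamental_Theorem_Algebra"
begin

section \<open>Characteristic polynomial and complex spectrum\<close>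

text \<open>Evaluation at \<open>z\<close> is a ring homomorphism, so it commutes with the Leibniz
  sum. This makes characteristic determinants accessible as polynomials.\<close>

lemma poly_det: "poly (det Q) z = det (\<chi> i j. poly (Q $ i $ j) z)"
  for Q :: "'a::comm_ring_1 poly ^ 'n ^ 'n"
  by (simp add: det_def poly_sum poly_prod)

lemma eigenvalue_iff_det:
  fixes M :: "'a::field ^ 'n ^ 'n"
  shows "(\<exists>x. x \<noteq> 0 \<and> M *v x = z *s x) \<longleftrightarrow> det (M - mat z) = 0"
proof -
  have "mat z *v x = z *s x" for x
    by (simp add: vec_eq_iff matrix_vector_mult_def mat_def if_distribR if_distrib[of "\<lambda>c. c * _"]
        cong: if_cong)
  then have "(M - mat z) *v x = M *v x - z *s x" for x
    by (simp add: vec_eq_iff matrix_vector_mult_def left_diff_distrib sum_subtractf)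
  then have "(\<exists>x. x \<noteq> 0 \<and> M *v x = z *s x) \<longleftrightarrow> \<not> (\<forall>x. (M - mat z) *v x = 0 \<longrightarrow> x = 0)"
    by auto
  also have "\<dots> \<longleftrightarrow> det (M - mat z) = 0"
    by (metis invertible_det_nz invertible_left_inverse matrix_left_invertible_ker)
  finally show ?thesis .
qed

text \<open>If \<open>det (M - z)\<close> were a constant \<open>c\<close>, then \<open>det (t M - 1) = t\<^sup>n c\<close> for \<open>t \<noteq> 0\<close>, and letting
  \<open>t\<close> tend to \<open>0\<close> would give \<open>det (- 1) = 0\<close>. A nonconstant polynomial has a nonempty finite set of
  roots.\<close>

lemma finite_nonempty_spectrum:
  fixes M :: "complex ^ 'n ^ 'n"
  shows "finite {z. det (M - mat z) = 0}" "{z. det (M - mat z) = 0} \<noteq> {}"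
proof -
  define p where "p = det (\<chi> i j. [:M $ i $ j, - (mat 1 $ i $ j):])"
  have p: "poly p z = det (M - mat z)" for z
    unfolding p_def poly_det by (rule arg_cong[of _ _ det]) (simp add: vec_eq_iff mat_def)
  define q where "q = det (\<chi> i j. [:- (mat 1 $ i $ j), M $ i $ j:])"
  have q: "poly q t = det (\<chi> i j. t * M $ i $ j - mat 1 $ i $ j)" for t
    unfolding q_def poly_det by (rule arg_cong[of _ _ det]) (simp add: vec_eq_iff)
  have nonconst: "\<not> constant (poly p)"
  proof
    assume "constant (poly p)"
    then have c: "poly p z = poly p 0" for z by (auto simp: constant_def)
    have qp: "poly q t = t ^ CARD('n) * poly p 0" if "t \<noteq> 0" for t
    proof -
      \<comment> \<open>For \<open>t \<noteq> 0\<close> the matrix \<open>t M - 1\<close> is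
        \<open>t (M - 1/t)\<close>; pulling \<open>t\<close> out of every row yields the power of
        \<open>t\<close>.\<close>
      have "poly q t = det (\<chi> i. t *s (M - mat (1 / t)) $ i)"
        unfolding q using that
        by (intro arg_cong[of _ _ det]) (simp add: vec_eq_iff mat_def algebra_simps)
      also have "\<dots> = t ^ CARD('n) * det (M - mat (1 / t))"
        by (subst det_rows_mul) (simp add: vec_lambda_eta)
      finally show ?thesis using c[of "1 / t"] by (simp add: p)
    qed
    \<comment> \<open>The limit is taken algebraically: two polynomials that agree at every nonzero
      point are equal, hence agree at \<open>0\<close> too.\<close>
    have "q = monom (poly p 0) CARD('n)"
    proof (rule ccontr)
      assume "q \<noteq> monom (poly p 0) CARD('n)"
      then have "finite {t. poly (q - monom (poly p 0) CARD('n)) t = 0}"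
        by (intro poly_roots_finite) simp
      moreover have "- {0} \<subseteq> {t. poly (q - monom (poly p 0) CARD('n)) t = 0}"
        using qp by (auto simp: poly_monom mult.commute)
      ultimately have "finite (- {0::complex})" by (rule rev_finite_subset)
      then have "finite (insert 0 (- {0::complex}))" by simp
      then show False using infinite_UNIV_char_0 by (metis finite_compl finite.emptyI finite_insert)
    qed
    \<comment> \<open>The monomial vanishes at \<open>0\<close> because its degree
      \<open>CARD('n)\<close> is positive.\<close>
    then have "poly q 0 = 0" by (simp add: poly_monom)
    moreover have "poly q 0 = (- 1) ^ CARD('n)"
    proof -
      have "poly q 0 = det (\<chi> i. (- 1) *s (mat 1 :: complex ^ 'n ^ 'n) $ i)"
        unfolding q by (intro arg_cong[of _ _ det]) (simp add: vec_eq_iff)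
      also have "\<dots> = (- 1) ^ CARD('n)"
        by (subst det_rows_mul) (simp add: vec_lambda_eta)
      finally show ?thesis .
    qed
    ultimately show False by simp
  qed
  then have "p \<noteq> 0" by (auto simp: constant_def)
  then show "finite {z. det (M - mat z) = 0}" using poly_roots_finite[of p] by (simp add: p)
  show "{z. det (M - mat z) = 0} \<noteq> {}"
    using fundamental_theorem_of_algebra[OF nonconst] by (simp add: p)
qed

text \<open>This makes the \<open>Max\<close> in \<open>spectral_radius\<close> a genuine maximum,
  attained by some eigenvalue.\<close>

lemma complex_eigenvalues_finite_nonempty:
  "finite (complex_eigenvalues A)" "complex_eigenvalues A \<noteq> {}"
  using finite_nonempty_spectrum[of "map_matrix complex_of_real A"]
  by (simp_all add: complex_eigenvalues_def eigenvalue_iff_det)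

lemma cmod_le_spectral_radius: "\<mu> \<in> complex_eigenvalues A \<Longrightarrow> cmod \<mu> \<le> spectral_radius A"
  unfolding spectral_radius_def by (simp add: complex_eigenvalues_finite_nonempty)

lemma spectral_radius_attained: "\<exists>\<mu>\<in>complex_eigenvalues A. cmod \<mu> = spectral_radius A"
  using Max_in[of "cmod ` complex_eigenvalues A"] complex_eigenvalues_finite_nonempty[of A]
  unfolding spectral_radius_def by fastforce

lemma spectral_radius_nonneg: "0 \<le> spectral_radius A"
  by (metis norm_ge_zero spectral_radius_attained)

section \<open>Spectral radius of a product in either order\<close>

lemma map_matrix_of_real_mult:
  "map_matrix complex_of_real (A ** B) = map_matrix complex_of_real A ** map_matrix complex_of_real B"
  by (simp add: map_matrix_def matrix_matrix_mult_def vec_eq_iff)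

text \<open>\<open>B\<close> sends an eigenvector \<open>x\<close> of \<open>A ** B\<close> to one
  of \<open>B ** A\<close>; the image is nonzero since \<open>A\<close> maps it to
  \<open>\<mu> *s x\<close>.\<close>

lemma complex_eigenvalues_commute:
  fixes A B :: "real ^ 'n ^ 'n"
  assumes "\<mu> \<in> complex_eigenvalues (A ** B)" "\<mu> \<noteq> 0"
  shows "\<mu> \<in> complex_eigenvalues (B ** A)"
proof -
  let ?A = "map_matrix complex_of_real A" and ?B = "map_matrix complex_of_real B"
  obtain x where x: "x \<noteq> 0" "?A *v (?B *v x) = \<mu> *s x"
    using assms(1)
    by (auto simp: complex_eigenvalues_def map_matrix_of_real_mult matrix_vector_mul_assoc)
  have "?B *v x \<noteq> 0"
  proof
    assume "?B *v x = 0"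
    then have "\<mu> *s x = 0" using x(2) by simp
    then show False using x(1) assms(2) by simp
  qed
  moreover have "(?B ** ?A) *v (?B *v x) = \<mu> *s (?B *v x)"
    by (simp add: x(2) vector_scalar_commute flip: matrix_vector_mul_assoc)
  ultimately show ?thesis
    by (auto simp: complex_eigenvalues_def map_matrix_of_real_mult)
qed

lemma spectral_radius_commute:
  fixes A B :: "real ^ 'n ^ 'n"
  shows "spectral_radius (A ** B) = spectral_radius (B ** A)"
proof -
  have le: "spectral_radius (A ** B) \<le> spectral_radius (B ** A)" for A B :: "real ^ 'n ^ 'n"
  proof -
    obtain \<mu> where \<mu>: "\<mu> \<in> complex_eigenvalues (A ** B)" "cmod \<mu> = spectral_radius (A ** B)"
      using spectral_radius_attained by blast
    show ?thesis
    proof (cases "\<mu> = 0")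
      case True
      then show ?thesis using \<mu>(2) spectral_radius_nonneg by (metis norm_zero)
    next
      case False
      then show ?thesis using \<mu> complex_eigenvalues_commute cmod_le_spectral_radius by metis
    qed
  qed
  show ?thesis using le[of A B] le[of B A] by simp
qed

section \<open>Perron-Frobenius theory for nonnegative matrices\<close>

text \<open>Take entrywise moduli of a complex eigenvector and apply the triangle inequality to each
  row.\<close>

lemma modulus_subeigenvector:
  fixes T :: "real ^ 'n ^ 'n"
  assumes "0 \<le> T" "\<mu> \<in> complex_eigenvalues T"
  shows "\<exists>a. 0 \<le> a \<and> a \<noteq> 0 \<and> cmod \<mu> *\<^sub>R a \<le> T *v a"
proof -
  obtain x where x: "x \<noteq> 0" "map_matrix complex_of_real T *v x = \<mu> *s x"
    using assms(2) by (auto simp: complex_eigenvalues_def)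
  define a where "a = (\<chi> i. cmod (x $ i))"
  have "cmod \<mu> * a $ i \<le> (T *v a) $ i" for i
  proof -
    have "\<mu> * x $ i = (\<Sum>j\<in>UNIV. of_real (T $ i $ j) * x $ j)"
      using arg_cong[OF x(2), of "\<lambda>v. v $ i"]
      by (simp add: matrix_vector_mult_def map_matrix_def)
    then have "cmod \<mu> * a $ i = cmod (\<Sum>j\<in>UNIV. of_real (T $ i $ j) * x $ j)"
      by (simp add: a_def flip: norm_mult)
    also have "\<dots> \<le> (\<Sum>j\<in>UNIV. cmod (of_real (T $ i $ j) * x $ j))" by (rule norm_sum)
    also have "\<dots> = (T *v a) $ i"
      using assms(1) by (simp add: matrix_vector_mult_def a_def norm_mult less_eq_vec_def)
    finally show ?thesis .
  qed
  moreover have "0 \<le> a" "a \<noteq> 0" using x(1) by (auto simp: a_def less_eq_vec_def vec_eq_iff)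
  ultimately show ?thesis by (auto simp: less_eq_vec_def)
qed

lemma matrix_vector_mono:
  fixes T :: "real ^ 'n ^ 'n"
  assumes "0 \<le> T" "x \<le> y"
  shows "T *v x \<le> T *v y"
  using assms by (auto simp: less_eq_vec_def matrix_vector_mult_def intro!: sum_mono mult_left_mono)

text \<open>The normalised map \<open>x \<mapsto> T x\<close> preserves the compact convex set of all \<open>x\<close> in the standard
  simplex with \<open>s x \<le> T x\<close>; a Brouwer fixed point is an eigenvector with eigenvalue at least \<open>s\<close>.\<close>

lemma spectral_radius_ge_subeigenvalue:
  fixes T :: "real ^ 'n ^ 'n"
  assumes T: "0 \<le> T" and w: "0 \<le> w" "w \<noteq> 0" and s: "0 < s" "s *\<^sub>R w \<le> T *v w"
  shows "s \<le> spectral_radius T"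
proof -
  define \<sigma> where "\<sigma> x = (\<Sum>i\<in>UNIV. x $ i)" for x :: "real ^ 'n"
  have \<sigma>_lin: "\<sigma> (x + y) = \<sigma> x + \<sigma> y" "\<sigma> (c *\<^sub>R x) = c * \<sigma> x" for x y c
    by (simp_all add: \<sigma>_def sum.distrib sum_distrib_left)
  have \<sigma>_mono: "\<sigma> x \<le> \<sigma> y" if "x \<le> y" for x y
    using that by (auto simp: \<sigma>_def less_eq_vec_def intro: sum_mono)
  define D where "D = {x. 0 \<le> x \<and> \<sigma> x = 1 \<and> s *\<^sub>R x \<le> T *v x}"
  define f where "f x = (1 / \<sigma> (T *v x)) *\<^sub>R (T *v x)" for x
  \<comment> \<open>The condition \<open>s x \<le> T x\<close> keeps the denominator in
    \<open>f\<close> at least \<open>s > 0\<close>, so \<open>f\<close> is well defined and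
    continuous on \<open>D\<close>.\<close>
  have \<sigma>T: "s \<le> \<sigma> (T *v x)" if "x \<in> D" for x
    using that \<sigma>_mono[of "s *\<^sub>R x" "T *v x"] by (simp add: D_def \<sigma>_lin)
  have "compact D"
  proof -
    have "closed D"
      unfolding D_def less_eq_vec_def \<sigma>_def matrix_vector_mult_def
      by (intro closed_Collect_conj closed_Collect_all closed_Collect_le closed_Collect_eq
          continuous_intros | simp)+
    moreover have "D \<subseteq> cbox 0 1"
    proof
      fix x assume "x \<in> D"
      then have x: "\<And>i. 0 \<le> x $ i" "\<sigma> x = 1" by (auto simp: D_def less_eq_vec_def)
      have "x $ i \<le> 1" for i
        using member_le_sum[of i UNIV "\<lambda>i. x $ i"] x by (simp add: \<sigma>_def)
      then show "x \<in> cbox 0 1" using x by (simp add: mem_box_cart)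
    qed
    ultimately show ?thesis by (meson bounded_cbox bounded_subset compact_eq_bounded_closed)
  qed
  moreover have "convex D"
  proof (rule convexI)
    fix x y :: "real ^ 'n" and u v :: real
    assume xy: "x \<in> D" "y \<in> D" and uv: "0 \<le> u" "0 \<le> v" "u + v = 1"
    have "u *\<^sub>R (s *\<^sub>R x) + v *\<^sub>R (s *\<^sub>R y) \<le> u *\<^sub>R (T *v x) + v *\<^sub>R (T *v y)"
      using xy uv by (intro add_mono scaleR_left_mono) (auto simp: D_def)
    moreover have "0 \<le> u *\<^sub>R x + v *\<^sub>R y"
      using xy uv by (intro add_nonneg_nonneg scaleR_nonneg_nonneg) (auto simp: D_def)
    ultimately show "u *\<^sub>R x + v *\<^sub>R y \<in> D"
      using xy uv
      by (simp add: D_def \<sigma>_lin matrix_vector_right_distrib matrix_vector_mult_scaleR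
          scaleR_right_distrib mult.commute)
  qed
  moreover have "D \<noteq> {}"
  proof -
    obtain i where "w $ i \<noteq> 0" using w(2) by (auto simp: vec_eq_iff)
    moreover have nonneg: "\<And>j. 0 \<le> w $ j" using w(1) by (simp add: less_eq_vec_def)
    ultimately have "0 < \<sigma> w"
      unfolding \<sigma>_def by (intro sum_pos2[of _ i]) (simp_all add: less_le)
    then have "(1 / \<sigma> w) *\<^sub>R w \<in> D"
      using w s scaleR_left_mono[OF s(2), of "1 / \<sigma> w"]
      by (simp add: D_def \<sigma>_lin matrix_vector_mult_scaleR scaleR_nonneg_nonneg)
    then show ?thesis by blast
  qed
  moreover have "continuous_on D f"
    unfolding f_def using \<sigma>T s(1)
    by (fastforce simp: \<sigma>_def matrix_vector_mult_def intro!: continuous_intros)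
  moreover have "f \<in> D \<rightarrow> D"
  proof
    fix x assume x: "x \<in> D"
    let ?c = "1 / \<sigma> (T *v x)"
    have c: "0 < ?c" using \<sigma>T[OF x] s(1) by simp
    \<comment> \<open>Applying the monotone map \<open>T\<close> to \<open>s x \<le> T x\<close>
      shows that the inequality survives one iteration.\<close>
    have "s *\<^sub>R (T *v x) \<le> T *v (T *v x)"
      using matrix_vector_mono[OF T, of "s *\<^sub>R x" "T *v x"] x
      by (simp add: D_def matrix_vector_mult_scaleR)
    then have "?c *\<^sub>R (s *\<^sub>R (T *v x)) \<le> ?c *\<^sub>R (T *v (T *v x))"
      using c by (intro scaleR_left_mono) auto
    moreover have "0 \<le> T *v x" using x mat_vec_nonneg[OF T] by (simp add: D_def)
    ultimately show "f x \<in> D"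
      using c by (simp add: D_def f_def \<sigma>_lin matrix_vector_mult_scaleR scaleR_nonneg_nonneg mult.commute)
  qed
  ultimately obtain x where x: "x \<in> D" "f x = x" using brouwer by metis
  \<comment> \<open>The normalising factor at the fixed point is the eigenvalue.\<close>
  define r where "r = \<sigma> (T *v x)"
  have r: "s \<le> r" using \<sigma>T[OF x(1)] by (simp add: r_def)
  have "T *v x = r *\<^sub>R f x" using r s(1) by (simp add: f_def r_def)
  then have Tx: "T *v x = r *\<^sub>R x" by (simp add: x(2))
  have "x \<noteq> 0" using x(1) by (auto simp: D_def \<sigma>_def)
  have "map_matrix complex_of_real T *v (\<chi> i. of_real (x $ i)) = of_real r *s (\<chi> i. of_real (x $ i))"
  proof -
    have "(\<Sum>j\<in>UNIV. T $ i $ j * x $ j) = r * x $ i" for i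
      using arg_cong[OF Tx, of "\<lambda>v. v $ i"] by (simp add: matrix_vector_mult_def)
    then show ?thesis
      by (simp add: vec_eq_iff matrix_vector_mult_def map_matrix_def flip: of_real_mult of_real_sum)
  qed
  moreover have "(\<chi> i. complex_of_real (x $ i)) \<noteq> 0" using \<open>x \<noteq> 0\<close> by (auto simp: vec_eq_iff)
  ultimately have "complex_of_real r \<in> complex_eigenvalues T"
    by (auto simp: complex_eigenvalues_def)
  then have "cmod (of_real r) \<le> spectral_radius T" by (rule cmod_le_spectral_radius)
  then show ?thesis using r by simp
qed

text \<open>Multiplying the modulus of an eigenvector by \<open>T\<close> once more moves it into the range of \<open>P\<close>.\<close>

lemma subeigenvector_in_range:
  fixes T :: "real ^ 'n ^ 'n"
  assumes T: "0 \<le> T" "P ** T = T" and pos: "0 < spectral_radius T"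
  obtains a where "0 \<le> a" "a \<noteq> 0" "P *v a = a" "spectral_radius T *\<^sub>R a \<le> T *v a"
proof -
  let ?s = "spectral_radius T"
  \<comment> \<open>\<open>b\<close> comes from an eigenvalue of maximal modulus.\<close>
  obtain b where b: "0 \<le> b" "b \<noteq> 0" "?s *\<^sub>R b \<le> T *v b"
    using modulus_subeigenvector[OF T(1)] spectral_radius_attained by metis
  show thesis
  proof (rule that[of "T *v b"])
    show "0 \<le> T *v b" using T(1) b(1) by (rule mat_vec_nonneg)
    show "T *v b \<noteq> 0"
    proof
      assume "T *v b = 0"
      then have "?s * b $ i \<le> 0" for i using b(3) by (auto simp: less_eq_vec_def)
      then have "b $ i \<le> 0" for i using pos by (simp add: mult_le_0_iff)
      then show False using b(1,2) by (auto simp: less_eq_vec_def vec_eq_iff intro: antisym)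
    qed
    show "P *v (T *v b) = T *v b" by (simp add: matrix_vector_mul_assoc T(2))
    show "?s *\<^sub>R (T *v b) \<le> T *v (T *v b)"
      using matrix_vector_mono[OF T(1) b(3)] by (simp add: matrix_vector_mult_scaleR)
  qed
qed

section \<open>Convergence and comparison of splittings\<close>

text \<open>A radius of at least \<open>1\<close> would give \<open>a \<le> T a\<close> with
  \<open>a\<close> nonzero, nonnegative and in the range of \<open>P = A G\<close>. Then
  \<open>W a = G (a - T a) \<le> 0\<close>, while \<open>W a \<ge> 0\<close>; so
  \<open>W a = 0\<close> and \<open>a = P a = U W a = 0\<close>, a contradiction.\<close>

lemma spectral_radius_proper_G_weak_regular_less_1:
  assumes G: "is_group_inverse A G" "0 \<le> G" and s: "proper_G_weak_regular_II A U V"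
  shows "spectral_radius (V ** group_inv U) < 1"
proof (rule ccontr)
  define T W where "T = V ** group_inv U" and "W = group_inv U"
  note f = splitting_facts[OF G(1) s, folded T_def W_def]
  have W: "is_group_inverse U W" and p: "proper_splitting A U V"
    using s is_group_inverse_group_inv by (auto simp: proper_G_weak_regular_II_def W_def)
  assume "\<not> spectral_radius (V ** group_inv U) < 1"
  then have ge: "1 \<le> spectral_radius T" by (simp add: T_def)
  then obtain a where a: "0 \<le> a" "a \<noteq> 0" "(A ** G) *v a = a" "spectral_radius T *\<^sub>R a \<le> T *v a"
    using subeigenvector_in_range[OF f(2,3)] by force
  have "a \<le> spectral_radius T *\<^sub>R a"
    using scaleR_right_mono[OF ge a(1)] by simp
  then have "a \<le> T *v a" using a(4) by simp
  then have "G *v a \<le> G *v (T *v a)" by (rule matrix_vector_mono[OF G(2)])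
  moreover have "W *v a = G *v a - G *v (T *v a)"
  proof -
    have "W *v a = G *v ((A ** G - T) *v a)" by (simp add: matrix_vector_mul_assoc f(5))
    also have "\<dots> = G *v (a - T *v a)" by (simp add: matrix_vector_mult_diff_rdistrib a(3))
    finally show ?thesis by (simp add: matrix_vector_mult_diff_distrib)
  qed
  ultimately have "W *v a \<le> 0" by simp
  then have "W *v a = 0" using mat_vec_nonneg[OF f(1) a(1)] by simp
  then have "(U ** W) *v a = 0" by (simp flip: matrix_vector_mul_assoc)
  then show False using proper_splitting_proj[OF G(1) W p] a(2,3) by simp
qed

text \<open>With \<open>P = A A\<^sup>#\<close>, \<open>M = U B\<^sup>#\<close> and \<open>T = V U\<^sup>#\<close> one has \<open>(P - T) M = P - C B\<^sup>#\<close>. If \<open>s\<close> is the spectral radius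
  of \<open>C B\<^sup>#\<close> and \<open>s a \<le> C B\<^sup># a\<close>, then \<open>(P - T) M a \<le> (1 - s) a \<le> (1 - s) M a\<close>, that is
  \<open>s M a \<le> T M a\<close>.\<close>

lemma spectral_radius_comparison:
  fixes A U V B C :: "real ^ 'n ^ 'n"
  assumes G: "is_group_inverse A G" "0 \<le> G"
    and s: "proper_G_weak_regular_II A U V" "proper_G_weak_regular_II A B C"
    and M: "mat 1 \<le> U ** group_inv B"
  shows "spectral_radius (C ** group_inv B) \<le> spectral_radius (V ** group_inv U)"
proof (cases "0 < spectral_radius (C ** group_inv B)")
  case False
  then show ?thesis using spectral_radius_nonneg[of "V ** group_inv U"] by linarith
next
  case pos: True
  define T S M where "T = V ** group_inv U" and "S = C ** group_inv B" and "M = U ** group_inv B"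
  define s where "s = spectral_radius S"
  note fT = splitting_facts[OF G(1) s(1), folded T_def]
  note fS = splitting_facts[OF G(1) s(2), folded S_def]
  have s0: "0 < s" "s < 1"
    using pos spectral_radius_proper_G_weak_regular_less_1[OF G s(2)] by (simp_all add: s_def S_def)
  obtain a where a: "0 \<le> a" "a \<noteq> 0" "(A ** G) *v a = a" "s *\<^sub>R a \<le> S *v a"
    using subeigenvector_in_range[OF fS(2,3)] pos by (auto simp: s_def S_def)
  have U: "is_group_inverse U (group_inv U)" and p: "proper_splitting A U V"
    and B: "is_group_inverse B (group_inv B)" and pB: "proper_splitting A B C"
    using s is_group_inverse_group_inv by (auto simp: proper_G_weak_regular_II_def)
  have BB: "B ** group_inv B = A ** G" by (rule proper_splitting_proj[OF G(1) B pB])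
  \<comment> \<open>The null space of \<open>U\<close> is that of \<open>A\<close>, hence is
    contained in that of \<open>V = U - A\<close>. The identity reduces \<open>T ** M\<close> to
    \<open>V ** group_inv B\<close>.\<close>
  have "V ** group_inv U ** U = V"
  proof -
    have "A ** group_inv U ** U = A"
      using proj_absorb_right[OF U] p by (simp add: proper_splitting_def)
    moreover have "U ** group_inv U ** U = U" using U unfolding is_group_inverse_def by blast
    moreover have "V = U - A" using p by (simp add: proper_splitting_def)
    ultimately show ?thesis by (simp add: mat_diff_left)
  qed
  then have "M - T ** M = (U - V) ** group_inv B"
    unfolding M_def T_def by (simp add: matrix_mul_assoc mat_diff_left)
  \<comment> \<open>Both differences are \<open>A\<close>; this links the two splittings.\<close>
  also have "U - V = B - C" using p pB by (simp add: proper_splitting_def)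
  finally have "M - T ** M = A ** G - S" by (simp add: mat_diff_left BB S_def)
  then have "(M - T ** M) *v a = (A ** G - S) *v a" by simp
  then have e: "M *v a - T *v (M *v a) = a - S *v a"
    by (simp add: matrix_vector_mult_diff_rdistrib a(3) matrix_vector_mul_assoc)
  have "0 \<le> M - mat 1" using assms(5) by (simp add: M_def)
  then have "0 \<le> (M - mat 1) *v a" using a(1) by (rule mat_vec_nonneg)
  then have Ma: "a \<le> M *v a" by (simp add: matrix_vector_mult_diff_rdistrib)
  \<comment> \<open>Multiplying \<open>a \<le> M a\<close> by \<open>1 - s\<close> keeps its
    direction because \<open>s < 1\<close>, by convergence of the splitting
    \<open>A = B - C\<close>.\<close>
  have "(1 - s) *\<^sub>R a \<le> (1 - s) *\<^sub>R (M *v a)" using Ma s0 by (intro scaleR_left_mono) auto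
  moreover have "a - S *v a \<le> (1 - s) *\<^sub>R a" using a(4) by (simp add: scaleR_left_diff_distrib)
  ultimately have "M *v a - T *v (M *v a) \<le> (1 - s) *\<^sub>R (M *v a)" using e by simp
  then have "s *\<^sub>R (M *v a) \<le> T *v (M *v a)" by (simp add: scaleR_left_diff_distrib)
  moreover have "0 \<le> M *v a" "M *v a \<noteq> 0" using Ma a(1,2) by auto
  ultimately have "s \<le> spectral_radius T"
    using spectral_radius_ge_subeigenvalue[OF fT(2)] s0(1) by blast
  then show ?thesis by (simp add: s_def S_def T_def)
qed

text \<open>Both sides equal \<open>W U - W A\<close> with \<open>W = group_inv U\<close>. The form
  \<open>G T A\<close> lets a product of iteration matrices telescope.\<close>

lemma splitting_iteration_conj:
  assumes G: "is_group_inverse A G" and s: "proper_G_weak_regular_II A U V"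
  shows "group_inv U ** V = G ** (V ** group_inv U) ** A"
proof -
  let ?W = "group_inv U"
  have W: "is_group_inverse U ?W" and p: "proper_splitting A U V"
    using s is_group_inverse_group_inv by (auto simp: proper_G_weak_regular_II_def)
  have V: "V = U - A" using p by (simp add: proper_splitting_def)
  have UW: "U ** ?W = A ** G" by (rule proper_splitting_proj[OF G W p])
  have comm: "A ** G = G ** A" "U ** ?W = ?W ** U" and GAG: "G ** A ** G = G"
    and W': "?W ** U ** ?W = ?W"
    using G W by (auto simp: is_group_inverse_def)
  have "G ** (V ** ?W) ** A = G ** (A ** G) ** A - G ** A ** ?W ** A"
    by (simp add: V mat_diff_left mat_diff_right matrix_mul_assoc UW)
  also have "G ** (A ** G) ** A = ?W ** U" using GAG UW comm by (metis matrix_mul_assoc)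
  also have "G ** A ** ?W = ?W" using UW comm W' by metis
  finally show ?thesis by (simp add: V mat_diff_right)
qed

section \<open>The three-step scheme\<close>

theorem theorem3p15:
  fixes A K L U V X Y H S B C :: "real ^ 'n ^ 'n"
  assumes "group_monotone A"
    and "proper_G_weak_regular_II A K L"
    and "proper_G_weak_regular_II A U V"
    and "proper_G_weak_regular_II A X Y"
    and "range ((*v) (K + X - A + Y ** group_inv U ** L)) = range ((*v) A)"
    and "null_space (K + X - A + Y ** group_inv U ** L) = null_space A"
    and "H = group_inv X ** Y ** group_inv U ** V ** group_inv K ** L"
    and "S = Y ** group_inv X ** V ** group_inv U ** L ** group_inv K"
    and "induced_splitting A S B C"
    and "mat 1 \<le> K ** group_inv B"
    and "mat 1 \<le> U ** group_inv B"
    and "mat 1 \<le> X ** group_inv B"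
  shows "spectral_radius H \<le> Min {spectral_radius (group_inv K ** L),
           spectral_radius (group_inv U ** V), spectral_radius (group_inv X ** Y)} \<and>
         Min {spectral_radius (group_inv K ** L),
           spectral_radius (group_inv U ** V), spectral_radius (group_inv X ** Y)} < 1"
proof -
  define G where "G = group_inv A"
  have G: "is_group_inverse A G" "0 \<le> G"
    using assms(1) is_group_inverse_group_inv by (auto simp: group_monotone_def G_def)
  have B: "proper_G_weak_regular_II A B C" "C ** group_inv B = S"
    using three_step_induced(2)[OF assms(1-4,8)] assms(9) by blast+
  define TK TU TX where T: "TK = L ** group_inv K" "TU = V ** group_inv U" "TX = Y ** group_inv X"
  note fK = splitting_facts[OF G(1) assms(2), folded T]
  note fU = splitting_facts[OF G(1) assms(3), folded T]
  have S: "S = TX ** TU ** TK" by (simp add: assms(8) T matrix_mul_assoc)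
  have "H = (group_inv X ** Y) ** (group_inv U ** V) ** (group_inv K ** L)"
    by (simp add: assms(7) matrix_mul_assoc)
  also have "\<dots> = (G ** TX ** A) ** (G ** TU ** A) ** (G ** TK ** A)"
    using splitting_iteration_conj[OF G(1)] assms(2-4) by (simp add: T)
  \<comment> \<open>Each inner \<open>A ** G\<close> is the projection that fixes the following
    \<open>T\<close> factor, so the product collapses to \<open>G ** S ** A\<close>.\<close>
  also have "\<dots> = G ** (TX ** (A ** G ** TU) ** (A ** G ** TK)) ** A"
    by (simp add: matrix_mul_assoc)
  finally have "H = G ** S ** A" by (simp only: fK(3) fU(3) S)
  \<comment> \<open>Moving \<open>A\<close> to the front leaves \<open>A ** G ** S\<close>, which is
    \<open>S\<close> because the range of \<open>S\<close> lies in that of the projection.\<close>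
  then have "spectral_radius H = spectral_radius (A ** (G ** S))"
    by (metis spectral_radius_commute)
  also have "A ** (G ** S) = S"
    using splitting_facts(3)[OF G(1) B(1)] B(2) by (simp add: matrix_mul_assoc)
  finally have "spectral_radius H = spectral_radius (C ** group_inv B)" by (simp add: B(2))
  \<comment> \<open>One comparison with \<open>A = B - C\<close> serves all three splittings;
    commuting the factors turns \<open>R ** group_inv Q\<close> into
    \<open>group_inv Q ** R\<close>.\<close>
  then have "spectral_radius H \<le> spectral_radius (group_inv Q ** R)"
    if "proper_G_weak_regular_II A Q R" "mat 1 \<le> Q ** group_inv B" for Q R
    using spectral_radius_comparison[OF G that(1) B(1) that(2)]
    by (simp add: spectral_radius_commute[of "group_inv Q"])
  \<comment> \<open>A single radius below \<open>1\<close> already bounds the minimum.\<close>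
  moreover have "spectral_radius (group_inv K ** L) < 1"
    using spectral_radius_proper_G_weak_regular_less_1[OF G assms(2)]
    by (simp add: spectral_radius_commute[of "group_inv K"])
  ultimately show ?thesis using assms(2-4,10-12) by (simp add: min_less_iff_disj)
qed

end
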